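(* Let $(X_1,Y_1),\dots,(X_6,Y_6)$ be i.i.d. pairs of random vectors from a joint distribution $P_{XY}$, with $X\in\mathbb{R}^p$ and $Y\in\mathbb{R}^q$, such that $\alpha^\top X$ and $\beta^\top Y$ have continuous distribution functions for $\lambda$-almost all $\alpha\in\mathbb{S}^{p-1}$ and $\lambda$-almost all $\beta\in\mathbb{S}^{q-1}$. Let $d\omega_2(u,v,\alpha,\beta)=dF_{\alpha^\top X}(u)\,dF_{\beta^\top Y}(v)\,d\lambda(\alpha)\,d\lambda(\beta)$. Then $$\int_{\mathbb{S}^{p-1}}\int_{\mathbb{S}^{q-1}}\int_{\mathbb{R}^2}\big[F_{\alpha^\top X,\beta^\top Y}(u,v)-F_{\alpha^\top X}(u)F_{\beta^\top Y}(v)\big]^2d\omega_2(u,v,\alpha,\beta)$$ $$=\mathbb{E}\Big[\Big(\tfrac12-\tfrac1{2\pi}\mathsf{Ang}(X_1-X_3,X_2-X_3)\Big)\Big(\tfrac12-\tfrac1{2\pi}\mathsf{Ang}(Y_1-Y_4,Y_2-Y_4)\Big)\Big]$$ $$+\mathbb{E}\Big[\Big(\tfrac12-\tfrac1{2\pi}\mathsf{Ang}(X_1-X_5,X_2-X_5)\Big)\Big(\tfrac12-\tfrac1{2\pi}\mathsf{Ang}(Y_3-Y_6,Y_4-Y_6)\Big)\Big]$$ $$-2\,\mathbb{E}\Big[\Big(\tfrac12-\tfrac1{2\pi}\mathsf{Ang}(X_1-X_4,X_2-X_4)\Big)\Big(\tfrac12-\tfrac1{2\pi}\mathsf{Ang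}(Y_1-Y_5,Y_3-Y_5)\Big)\Big].$$
   Context: $\lambda$ denotes the uniform probability measure on the relevant unit sphere ($\mathbb{S}^{p-1}\subset\mathbb{R}^p$ or $\mathbb{S}^{q-1}\subset\mathbb{R}^q$). $F_{\alpha^\top X}$, $F_{\beta^\top Y}$ and $F_{\alpha^\top X,\beta^\top Y}$ are the marginal and joint distribution functions of $\alpha^\top X$ and $\beta^\top Y$, $(X,Y)\sim P_{XY}$. For nonzero vectors $U_1,U_2$ of the same dimension, $\mathsf{Ang}(U_1,U_2)=\arccos\{U_1^\top U_2/(\|U_1\|\|U_2\|)\}$. *)

theory Defs
  imports "HOL-Probability.Probability"
begin

text \<open>
  The uniform probability measure on the unit sphere: the law of \<open>x / norm x\<close> for \<open>x\<close> uniformly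
  distributed on the unit ball (for \<open>DIM('a) = 1\<close>: mass \<open>1/2\<close> on each of the two unit vectors).
  By \<open>distr_unif_sphere\<close> below it is invariant under all orthogonal transformations, and there is
  only one such Borel probability measure on the sphere.
  \<open>sgn\<close> maps \<open>0\<close> to \<open>0\<close>, which is off the sphere, but this is a null event.
\<close>

definition unif_sphere :: "'a::euclidean_space measure" where
  "unif_sphere =
     restrict_space (distr (uniform_measure lborel (ball 0 1)) borel sgn) (sphere 0 1)"

definition Ang :: "'a::real_inner \<Rightarrow> 'a \<Rightarrow> real" where
  "Ang U V = arccos ((U \<bullet> V) / (norm U * norm V))"

definition cdf_X :: "('a::euclidean_space \<times> 'b::euclidean_space) measure \<Rightarrow> 'a \<Rightarrow> real \<Rightarrow> real" where
  "cdf_X P \<alpha> = cdf (distr P borel (\<lambda>(x, y). \<alpha> \<bullet> x))"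

definition cdf_Y :: "('a::euclidean_space \<times> 'b::euclidean_space) measure \<Rightarrow> 'b \<Rightarrow> real \<Rightarrow> real" where
  "cdf_Y P \<beta> = cdf (distr P borel (\<lambda>(x, y). \<beta> \<bullet> y))"

definition cdf_XY ::
    "('a::euclidean_space \<times> 'b::euclidean_space) measure \<Rightarrow> 'a \<Rightarrow> 'b \<Rightarrow> real \<Rightarrow> real \<Rightarrow> real" where
  "cdf_XY P \<alpha> \<beta> u v = measure (distr P borel (\<lambda>(x, y). (\<alpha> \<bullet> x, \<beta> \<bullet> y))) ({..u} \<times> {..v})"

lemma space_unif_sphere [simp]: "space unif_sphere = sphere 0 1"
  by (simp add: unif_sphere_def space_restrict_space)

lemma sets_unif_sphere [simp, measurable_cong]:
  "sets unif_sphere = sets (restrict_space borel (sphere 0 1))"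
  unfolding unif_sphere_def by (intro sets_restrict_space_cong) simp

lemma prob_space_uniform_ball:
  "prob_space (uniform_measure lborel (ball 0 1 :: 'a::euclidean_space set))"
proof (rule prob_space_uniform_measure)
  show "emeasure lborel (ball 0 1 :: 'a set) \<noteq> 0"
    using content_ball_pos[of 1 "0::'a"]
    by (auto simp: measure_def)
  show "emeasure lborel (ball 0 1 :: 'a set) \<noteq> \<infinity>"
    using emeasure_bounded_finite[of "ball 0 1 :: 'a set"] by simp
qed

lemma prob_space_unif_sphere: "prob_space (unif_sphere :: 'a::euclidean_space measure)"
proof -
  let ?U = "uniform_measure lborel (ball 0 1 :: 'a set)"
  let ?D = "distr ?U borel sgn"
  interpret U: prob_space ?U by (rule prob_space_uniform_ball)
  interpret D: prob_space ?D by (rule U.prob_space_distr) simp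
  have "AE x in lborel. x \<noteq> (0::'a)"
    by (rule AE_lborel_singleton)
  then have "AE x in ?U. sgn x \<in> sphere (0::'a) 1"
    by (intro AE_uniform_measureI) (auto simp: norm_sgn)
  then have "AE x in ?D. x \<in> sphere 0 1"
    by (subst AE_distr_iff) auto
  then show ?thesis
    unfolding unif_sphere_def
    by (intro prob_space_restrict_space D.emeasure_eq_1_AE) auto
qed

lemma distr_lborel_orthogonal:
  fixes T :: "'a::euclidean_space \<Rightarrow> 'a"
  assumes T: "orthogonal_transformation T"
  shows "distr lborel borel T = lborel"
proof -
  define N where "N = distr lborel borel T"
  define B where "B = (ball 0 1 :: 'a set)"
  have lin: "linear T" by (rule orthogonal_transformation_linear[OF T])
  have T_meas [measurable]: "T \<in> borel_measurable borel"
    by (intro borel_measurable_continuous_onI linear_continuous_on) (simp add: lin linear_conv_bounded_linear[symmetric])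
  have sets_N [simp, measurable_cong]: "sets N = sets borel"
    by (simp add: N_def)
  have space_N [simp]: "space N = UNIV"
    by (simp add: N_def)
  have shift: "(\<integral>\<^sup>+x. f (x + c) \<partial>lborel) = (\<integral>\<^sup>+x. f x \<partial>lborel)"
    if [measurable]: "f \<in> borel_measurable borel" for f :: "'a \<Rightarrow> ennreal" and c
  proof -
    have "(\<integral>\<^sup>+x. f x \<partial>lborel) = (\<integral>\<^sup>+x. f x \<partial>distr lborel borel ((+) c))"
      by (simp add: lborel_distr_plus)
    then show ?thesis
      by (simp add: nn_integral_distr add.commute)
  qed
  have shift_N: "(\<integral>\<^sup>+x. f (x + c) \<partial>N) = (\<integral>\<^sup>+x. f x \<partial>N)"
    if [measurable]: "f \<in> borel_measurable borel" for f :: "'a \<Rightarrow> ennreal" and c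
  proof -
    obtain d where d: "T d = c"
      using orthogonal_transformation_surj[OF T] by (metis surjD)
    have "(\<integral>\<^sup>+x. f (x + c) \<partial>N) = (\<integral>\<^sup>+x. f (T (x + d)) \<partial>lborel)"
      by (simp add: N_def nn_integral_distr linear_add[OF lin] d)
    also have "\<dots> = (\<integral>\<^sup>+x. f (T x) \<partial>lborel)"
      by (rule shift[of "\<lambda>x. f (T x)"]) simp
    finally show ?thesis by (simp add: N_def nn_integral_distr)
  qed
  have norm_T: "norm (T x) = norm x" for x
    using T by (simp add: orthogonal_transformation)
  have ball: "emeasure N B = emeasure lborel B"
  proof -
    have "T -` B = B" by (auto simp: B_def norm_T)
    then show ?thesis by (simp add: N_def emeasure_distr B_def)
  qed
  have B0: "emeasure lborel B \<noteq> 0"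
    using content_ball_pos[of 1 "0::'a"] by (auto simp: measure_def B_def)
  have Binf: "emeasure lborel B \<noteq> \<infinity>"
    using emeasure_bounded_finite[of B] by (simp add: B_def)
  have B_sets [measurable]: "B \<in> sets borel" by (simp add: B_def)
  have "sigma_finite_measure N"
    unfolding sigma_finite_measure_def
  proof (intro exI[of _ "range (\<lambda>n. ball 0 (real n))"] conjI ballI)
    show "\<Union> (range (\<lambda>n. ball (0::'a) (real n))) = space N"
      by (auto simp: reals_Archimedean2)
  next
    fix A assume "A \<in> range (\<lambda>n. ball (0::'a) (real n))"
    then obtain n where A: "A = ball 0 (real n)" by auto
    have "T -` ball 0 (real n) = ball 0 (real n)" by (auto simp: norm_T)
    then have "emeasure N A = emeasure lborel (ball (0::'a) (real n))"
      by (simp add: N_def emeasure_distr A)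
    then show "emeasure N A \<noteq> \<infinity>"
      using emeasure_bounded_finite[of "ball (0::'a) (real n)"] by simp
  qed auto
  then interpret pair_sigma_finite N lborel
    by (simp add: pair_sigma_finite_def sigma_finite_lborel)
  have "emeasure N A = emeasure lborel A" if A [measurable]: "A \<in> sets borel" for A
  proof -
    have "emeasure N A * emeasure lborel B = (\<integral>\<^sup>+x. indicator A x * (\<integral>\<^sup>+y. indicator B (y + (- x)) \<partial>lborel) \<partial>N)"
      by (subst shift) (auto simp: nn_integral_multc)
    also have "\<dots> = (\<integral>\<^sup>+x. \<integral>\<^sup>+y. indicator A x * indicator B (y - x) \<partial>lborel \<partial>N)"
      by (intro nn_integral_cong) (simp add: nn_integral_cmult)
    also have "\<dots> = (\<integral>\<^sup>+y. \<integral>\<^sup>+x. indicator A x * indicator B (y - x) \<partial>N \<partial>lborel)"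
      by (rule Fubini'[symmetric]) measurable
    also have "\<dots> = (\<integral>\<^sup>+y. \<integral>\<^sup>+x. indicator A (x + y) * indicator B (y - (x + y)) \<partial>N \<partial>lborel)"
      by (intro nn_integral_cong shift_N[symmetric]) measurable
    also have "\<dots> = (\<integral>\<^sup>+y. \<integral>\<^sup>+x. indicator A (x + y) * indicator B x \<partial>N \<partial>lborel)"
      by (intro nn_integral_cong) (auto simp: B_def split: split_indicator)
    also have "\<dots> = (\<integral>\<^sup>+x. \<integral>\<^sup>+y. indicator A (x + y) * indicator B x \<partial>lborel \<partial>N)"
      by (rule Fubini') measurable
    also have "\<dots> = (\<integral>\<^sup>+x. (\<integral>\<^sup>+y. indicator A (y + x) \<partial>lborel) * indicator B x \<partial>N)"
      by (intro nn_integral_cong) (simp add: nn_integral_multc add.commute)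
    also have "\<dots> = emeasure lborel A * emeasure lborel B"
      by (subst shift) (auto simp: nn_integral_cmult ball)
    finally show ?thesis
      using B0 Binf by (metis ennreal_mult_cancel_left infinity_ennreal_def mult.commute)
  qed
  then show ?thesis
    unfolding N_def[symmetric] by (intro measure_eqI) auto
qed

lemma distr_unif_sphere:
  fixes T :: "'a::euclidean_space \<Rightarrow> 'a"
  assumes T: "orthogonal_transformation T"
  shows "distr unif_sphere unif_sphere T = unif_sphere"
proof -
  define U where "U = uniform_measure lborel (ball 0 1 :: 'a set)"
  have lin: "linear T" by (rule orthogonal_transformation_linear[OF T])
  have T_meas [measurable]: "T \<in> borel_measurable borel"
    by (intro borel_measurable_continuous_onI linear_continuous_on) (simp add: lin linear_conv_bounded_linear[symmetric])
  have norm_T: "norm (T x) = norm x" for x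
    using T by (simp add: orthogonal_transformation)
  have sgn_T: "sgn (T x) = T (sgn x)" for x
    by (simp add: sgn_div_norm norm_T linear_cmul[OF lin])
  have [simp, measurable_cong]: "sets U = sets borel" and [simp]: "space U = UNIV"
    by (simp_all add: U_def)
  have inv: "emeasure U (T -` A) = emeasure U A" if [measurable]: "A \<in> sets borel" for A
  proof -
    have TA: "T -` A \<in> sets borel"
      using measurable_sets[OF T_meas, of A] by simp
    have "ball 0 1 \<inter> T -` A = T -` (ball 0 1 \<inter> A)"
      by (auto simp: norm_T)
    then have "emeasure lborel (ball 0 1 \<inter> T -` A) = emeasure (distr lborel borel T) (ball 0 1 \<inter> A)"
      by (simp add: emeasure_distr)
    then show ?thesis
      using TA by (simp add: U_def distr_lborel_orthogonal[OF T])
  qed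
  have sph: "emeasure unif_sphere A = emeasure U (sgn -` A)"
    if "A \<in> sets (unif_sphere :: 'a measure)" for A
  proof -
    from that have A: "A \<in> sets borel" "A \<subseteq> sphere 0 1"
      by (auto simp: sets_restrict_space)
    then show ?thesis
      unfolding unif_sphere_def U_def[symmetric]
      by (subst emeasure_restrict_space) (auto simp: emeasure_distr)
  qed
  have T_sph: "T \<in> unif_sphere \<rightarrow>\<^sub>M unif_sphere"
    by (simp add: measurable_cong_sets[OF sets_unif_sphere sets_unif_sphere])
       (auto intro!: measurable_restrict_space3 simp: norm_T)
  show ?thesis
  proof (rule measure_eqI)
    fix A assume "A \<in> sets (distr unif_sphere unif_sphere T)"
    then have A: "A \<in> sets (unif_sphere :: 'a measure)" by simp
    then have A': "A \<in> sets borel" "A \<subseteq> sphere 0 1"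
      by (auto simp: sets_restrict_space)
    have "sgn -` A \<in> sets (borel :: 'a measure)"
      using measurable_sets[OF borel_measurable_sgn, of A] A' by simp
    moreover have "sgn -` (T -` A \<inter> sphere 0 1) = T -` (sgn -` A)"
    proof (intro set_eqI iffI)
      fix x assume "x \<in> T -` (sgn -` A)"
      then show "x \<in> sgn -` (T -` A \<inter> sphere 0 1)"
        using A' norm_T[of "sgn x"] by (auto simp: sgn_T)
    qed (auto simp: sgn_T)
    ultimately have "emeasure U (sgn -` (T -` A \<inter> sphere 0 1)) = emeasure U (sgn -` A)"
      by (simp add: inv)
    moreover have "T -` A \<inter> sphere 0 1 \<in> sets unif_sphere"
      using measurable_sets[OF T_sph A] by simp
    ultimately show "emeasure (distr unif_sphere unif_sphere T) A = emeasure unif_sphere A"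
      using A by (simp add: emeasure_distr[OF T_sph] sph)
  qed simp
qed

end

theory Submission
  imports Defs
begin

text \<open>
  For fixed directions, expand the square: a product of distribution functions, evaluated at an
  independent pair of observations, is the probability of an intersection of events about
  independent copies. Exchanging the integral over the directions with the expectation leaves
  spherical measures of wedges \<open>{\<alpha>. \<alpha> \<bullet> U \<le> 0 \<and> \<alpha> \<bullet> V \<le> 0}\<close>. The mass of a lune is additive in its
  opening angle by rotation invariance, hence linear, so such a wedge has mass
  \<open>1/2 - Ang U V / (2 * pi)\<close>. This fails when \<open>U\<close> or \<open>V\<close> vanishes; continuity of the projected
  distribution functions, in a single direction, shows that differences of independent
  observations are almost surely nonzero.
\<close>

section \<open>The uniform measure on the sphere: invariance, hyperplanes, half-spaces\<close>

lemma measurable_ident_unif_sphere [measurable]: "(\<lambda>x. x) \<in> unif_sphere \<rightarrow>\<^sub>M borel"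
  by (simp add: measurable_cong_sets[OF sets_unif_sphere refl] measurable_restrict_space1)

text \<open>\<open>distr_unif_sphere\<close> restated for events given by a predicate, the form in
  which the antipodal map and the plane rotations are applied.\<close>

lemma measure_unif_sphere_orthogonal_transformation:
  fixes T :: "'a::euclidean_space \<Rightarrow> 'a"
  assumes T: "orthogonal_transformation T" and Q [measurable]: "Measurable.pred unif_sphere Q"
  shows "measure unif_sphere {a \<in> space unif_sphere. Q (T a)}
       = measure unif_sphere {a \<in> space unif_sphere. Q a}"
proof -
  have lin: "linear T" by (rule orthogonal_transformation_linear[OF T])
  have norm_T: "norm (T x) = norm x" for x
    using T by (simp add: orthogonal_transformation)
  have T_meas: "T \<in> borel_measurable borel"
    by (intro borel_measurable_continuous_onI linear_continuous_on)
       (simp add: lin linear_conv_bounded_linear[symmetric])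
  have T_sph: "T \<in> unif_sphere \<rightarrow>\<^sub>M unif_sphere"
    using T_meas
    by (simp add: measurable_cong_sets[OF sets_unif_sphere sets_unif_sphere])
       (auto intro!: measurable_restrict_space3 simp: norm_T)
  have "measure unif_sphere {a \<in> space unif_sphere. Q a}
      = measure (distr unif_sphere unif_sphere T) {a \<in> space unif_sphere. Q a}"
    by (simp only: distr_unif_sphere[OF T])
  also have "\<dots> = measure unif_sphere (T -` {a \<in> space unif_sphere. Q a} \<inter> space unif_sphere)"
    by (rule measure_distr[OF T_sph]) measurable
  also have "T -` {a \<in> space unif_sphere. Q a} \<inter> space unif_sphere
           = {a \<in> space unif_sphere. Q (T a)}"
    by (auto simp: norm_T)
  finally show ?thesis by simp
qed

text \<open>A hyperplane through the origin is Lebesgue-null and \<open>sgn\<close> only rescales,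
  so the null set passes to the sphere. This makes strict and weak inequalities interchangeable
  below.\<close>

lemma AE_unif_sphere_inner_neq_0:
  fixes u :: "'a::euclidean_space"
  assumes "u \<noteq> 0"
  shows "AE a in unif_sphere. a \<bullet> u \<noteq> 0"
proof -
  have "negligible {x. u \<bullet> x = 0}"
    using assms by (intro negligible_hyperplane) auto
  then have "AE x in lebesgue. x \<notin> {x. u \<bullet> x = 0}"
    unfolding negligible_iff_null_sets by (rule AE_not_in)
  then have "AE x in lborel. x \<bullet> u \<noteq> 0"
    by (subst (asm) AE_completion_iff) (auto simp: inner_commute)
  then have "AE x in lborel. x \<in> ball 0 1 \<longrightarrow> sgn x \<bullet> u \<noteq> 0"
    by eventually_elim (auto simp: sgn_div_norm)
  then have "AE x in uniform_measure lborel (ball 0 1). sgn x \<bullet> u \<noteq> 0"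
    by (intro AE_uniform_measureI) auto
  then have "AE a in distr (uniform_measure lborel (ball 0 1)) borel sgn. a \<bullet> u \<noteq> 0"
    by (subst AE_distr_iff) (auto simp: measurable_cong_sets[OF sets_uniform_measure refl])
  then show ?thesis
    unfolding unif_sphere_def by (subst AE_restrict_space_iff) auto
qed

text \<open>The antipodal map exchanges the half-space with its complement, up to a null
  hyperplane.\<close>

lemma measure_unif_sphere_halfspace:
  fixes u :: "'a::euclidean_space"
  assumes "u \<noteq> 0"
  shows "measure unif_sphere {a \<in> space unif_sphere. a \<bullet> u \<le> 0} = 1/2"
proof -
  interpret prob_space "unif_sphere :: 'a measure" by (rule prob_space_unif_sphere)
  let ?H = "{a \<in> space unif_sphere. a \<bullet> u \<le> 0}"
  have "prob {a \<in> space unif_sphere. (- a) \<bullet> u \<le> 0} = prob ?H"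
    by (intro measure_unif_sphere_orthogonal_transformation[where T = uminus])
       (auto simp: orthogonal_transformation_neg[of "\<lambda>x. x"])
  moreover have "prob {a \<in> space unif_sphere. (- a) \<bullet> u \<le> 0} = prob {a \<in> space unif_sphere. \<not> a \<bullet> u \<le> 0}"
  proof (rule finite_measure_eq_AE)
    show "AE a in unif_sphere. a \<in> {a \<in> space unif_sphere. (- a) \<bullet> u \<le> 0}
      \<longleftrightarrow> a \<in> {a \<in> space unif_sphere. \<not> a \<bullet> u \<le> 0}"
      using AE_unif_sphere_inner_neq_0[OF assms] by eventually_elim auto
  qed measurable
  moreover have "prob {a \<in> space unif_sphere. \<not> a \<bullet> u \<le> 0} = 1 - prob ?H"
    by (intro prob_neg) measurable
  ultimately show ?thesis by simp
qed

section \<open>Lunes and wedges: the mass is linear in the angle\<close>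

text \<open>Cauchy's functional equation on an interval. Nonnegativity makes \<open>h\<close>
  monotone, which replaces continuity: \<open>t\<close> is enclosed between consecutive multiples of
  \<open>c / n\<close>, and \<open>n\<close> tends to infinity.\<close>

lemma nonneg_additive_linear:
  fixes h :: "real \<Rightarrow> real"
  assumes c: "0 < c" and t: "0 \<le> t" "t \<le> c"
    and add: "\<And>x y. 0 \<le> x \<Longrightarrow> 0 \<le> y \<Longrightarrow> x + y \<le> c \<Longrightarrow> h (x + y) = h x + h y"
    and nonneg: "\<And>x. 0 \<le> x \<Longrightarrow> x \<le> c \<Longrightarrow> 0 \<le> h x"
  shows "h t = t / c * h c"
proof -
  have mono: "h x \<le> h y" if "0 \<le> x" "x \<le> y" "y \<le> c" for x y
    using add[of x "y - x"] nonneg[of "y - x"] that by simp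
  have h0: "h 0 = 0" using add[of 0 0] c by simp
  have mult: "real k * x \<le> c \<Longrightarrow> h (real k * x) = real k * h x" if "0 \<le> x" for k x
  proof (induction k)
    case (Suc k)
    then have "real k * x \<le> c" using that by (simp add: algebra_simps)
    with Suc show ?case
      using add[of "real k * x" x] that by (simp add: algebra_simps)
  qed (simp add: h0)
  \<comment> \<open>Both \<open>h t\<close> and \<open>t / c * h c\<close> lie between
    \<open>real k * h d\<close> and \<open>real (Suc k) * h d\<close>, where \<open>k\<close> is the
    number of whole grid steps of length \<open>d = c / n\<close> contained in
    \<open>t\<close>.\<close>
  have bound: "\<bar>h t - t / c * h c\<bar> \<le> h c / real n" if n: "n > 0" for n :: nat
  proof -
    define d where "d = c / real n"
    have d: "d > 0" "real n * d = c" using c n by (auto simp: d_def)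
    have hd: "real n * h d = h c" using mult[of d n] d by simp
    define k where "k = nat \<lfloor>t / d\<rfloor>"
    have "real k = of_int \<lfloor>t / d\<rfloor>" using t d by (simp add: k_def)
    then have "real k \<le> t / d" "t / d < real k + 1" by linarith+
    then have k: "real k * d \<le> t" "t \<le> real (Suc k) * d" using d by (auto simp: field_simps)
    have lo: "real k * h d \<le> h t"
      using mono[of "real k * d" t] mult[of d k] k d t by simp
    have hi: "h t \<le> real (Suc k) * h d"
    proof (cases "real (Suc k) * d \<le> c")
      case True
      then show ?thesis using mono[of t "real (Suc k) * d"] mult[of d "Suc k"] k d t by simp
    next
      \<comment> \<open>The upper grid point may lie beyond \<open>c\<close>, where nothing is
        assumed about \<open>h\<close>; then \<open>k + 1 > n\<close>, and
        \<open>h t \<le> h c = n * h d\<close> suffices.\<close>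
      case False
      then have "real n < real (Suc k)" using d by (metis mult_le_cancel_right_pos not_le)
      then have "real n * h d \<le> real (Suc k) * h d"
        using nonneg[of d] d c n by (intro mult_right_mono) (auto simp: d_def field_simps)
      then show ?thesis using mono[of t c] hd t by simp
    qed
    have hd': "t / c * h c = (t / d) * h d" using hd d c n by (auto simp: d_def)
    have hd0: "0 \<le> h d" using nonneg[of d] d c n by (auto simp: d_def field_simps)
    have "real k * h d \<le> t / d * h d"
      using k(1) d hd0 by (intro mult_right_mono) (auto simp: field_simps)
    moreover have "t / d * h d \<le> real (Suc k) * h d"
      using k(2) d hd0 by (intro mult_right_mono) (auto simp: field_simps)
    ultimately have "\<bar>h t - t / c * h c\<bar> \<le> h d"
      unfolding hd' using lo hi by (simp add: algebra_simps)
    also have "h d = h c / real n" using hd n by (simp add: field_simps)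
    finally show ?thesis .
  qed
  have "(\<lambda>n. h c / real n) \<longlonglongrightarrow> 0" by (rule lim_const_over_n)
  then have "\<bar>h t - t / c * h c\<bar> \<le> 0"
    by (rule LIMSEQ_le_const) (use bound in \<open>auto intro!: exI[of _ 1]\<close>)
  then show ?thesis by simp
qed

text \<open>The rotation by \<open>s\<close> in the plane of \<open>e\<close> and \<open>f\<close>
  carries the vector at angle \<open>t\<close> to the one at angle \<open>s + t\<close> and
  preserves inner products. The conclusion is phrased by inner products because lunes are.\<close>

lemma orthogonal_transformation_plane_rotation:
  fixes e f :: "'a::euclidean_space"
  assumes e: "norm e = 1" and f: "norm f = 1" and ef: "e \<bullet> f = 0"
  obtains T where "orthogonal_transformation T"
    "\<And>x t. T x \<bullet> (cos (s + t) *\<^sub>R e + sin (s + t) *\<^sub>R f) = x \<bullet> (cos t *\<^sub>R e + sin t *\<^sub>R f)"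
proof -
  define c where "c = cos s"
  define d where "d = sin s"
  \<comment> \<open>Only the component of \<open>x\<close> in the plane is moved, hence
    \<open>c - 1\<close> in place of \<open>c\<close>; the orthogonal complement stays
    fixed.\<close>
  define T where "T x = x + ((c - 1) * (x \<bullet> e) - d * (x \<bullet> f)) *\<^sub>R e
                          + (d * (x \<bullet> e) + (c - 1) * (x \<bullet> f)) *\<^sub>R f" for x
  have cd: "c\<^sup>2 + d\<^sup>2 = 1" by (simp add: c_def d_def)
  have ee: "e \<bullet> e = 1" and ff: "f \<bullet> f = 1" and fe: "f \<bullet> e = 0"
    using e f ef by (simp_all add: norm_eq_1 inner_commute)
  have Te: "T x \<bullet> e = c * (x \<bullet> e) - d * (x \<bullet> f)"
    and Tf: "T x \<bullet> f = d * (x \<bullet> e) + c * (x \<bullet> f)" for x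
    by (simp_all add: T_def inner_simps ee ff ef fe algebra_simps)
  have "linear T"
    by (rule linearI) (simp_all add: T_def inner_simps algebra_simps)
  moreover have "norm (T x) = norm x" for x
  proof -
    have *: "T x \<bullet> T x = x \<bullet> x + (c\<^sup>2 + d\<^sup>2 - 1) * ((x \<bullet> e)\<^sup>2 + (x \<bullet> f)\<^sup>2)"
      by (simp add: T_def inner_simps ee ff ef fe inner_commute[of e x] inner_commute[of f x]
            power2_eq_square algebra_simps)
    show ?thesis unfolding norm_eq_sqrt_inner * cd by simp
  qed
  ultimately have "orthogonal_transformation T"
    by (simp add: orthogonal_transformation)
  moreover have "T x \<bullet> (cos (s + t) *\<^sub>R e + sin (s + t) *\<^sub>R f)
               = x \<bullet> (cos t *\<^sub>R e + sin t *\<^sub>R f)" for x t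
  proof -
    have "T x \<bullet> (cos (s + t) *\<^sub>R e + sin (s + t) *\<^sub>R f)
        = (c\<^sup>2 + d\<^sup>2) * (cos t * (x \<bullet> e) + sin t * (x \<bullet> f))"
      by (simp add: inner_simps Te Tf cos_add sin_add c_def[symmetric] d_def[symmetric]
            power2_eq_square algebra_simps)
    then show ?thesis by (simp add: cd inner_simps)
  qed
  ultimately show ?thesis by (rule that)
qed

text \<open>A lune of opening \<open>x + y\<close> is cut by the hyperplane at angle
  \<open>x\<close> into a lune of opening \<open>x\<close> and a rotated copy of one of opening
  \<open>y\<close>. So the mass is additive in the opening, hence linear, and at opening
  \<open>pi\<close> the lune is a half-space.\<close>

lemma measure_unif_sphere_lune:
  fixes e f :: "'a::euclidean_space"
  assumes e: "norm e = 1" and f: "norm f = 1" and ef: "e \<bullet> f = 0" and t: "0 \<le> t" "t \<le> pi"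
  shows "measure unif_sphere {a \<in> space unif_sphere. a \<bullet> e \<le> 0 \<and> a \<bullet> (cos t *\<^sub>R e + sin t *\<^sub>R f) > 0}
       = t / (2 * pi)"
proof -
  interpret prob_space "unif_sphere :: 'a measure" by (rule prob_space_unif_sphere)
  define u where "u t = cos t *\<^sub>R e + sin t *\<^sub>R f" for t
  \<comment> \<open>One inequality is weak and the other strict, so that adjacent lunes are exactly
    disjoint and \<open>L 0 0\<close> is empty.\<close>
  define L where "L s t = {a \<in> space unif_sphere. a \<bullet> u s \<le> 0 \<and> a \<bullet> u t > 0}" for s t
  define h where "h t = prob (L 0 t)" for t
  have [measurable]: "L s t \<in> events" for s t unfolding L_def by measurable
  have u_neq_0: "u t \<noteq> 0" for t
  proof -
    have "u t \<bullet> u t = (cos t)\<^sup>2 + (sin t)\<^sup>2"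
      using e f ef by (simp add: u_def inner_simps norm_eq_1 inner_commute power2_eq_square)
    then show ?thesis by auto
  qed
  have u0: "u 0 = e" and upi: "u pi = - e" by (simp_all add: u_def)
  have rot: "prob (L s (s + t)) = h t" for s t
  proof -
    obtain T where T: "orthogonal_transformation T" "\<And>x t. T x \<bullet> u (s + t) = x \<bullet> u t"
      using orthogonal_transformation_plane_rotation[OF e f ef, of s] unfolding u_def by metis
    have "prob {a \<in> space unif_sphere. T a \<bullet> u s \<le> 0 \<and> T a \<bullet> u (s + t) > 0} = prob (L s (s + t))"
      unfolding L_def
      by (intro measure_unif_sphere_orthogonal_transformation[OF T(1)]) measurable
    \<comment> \<open>The instance at angle \<open>0\<close> reads \<open>u s\<close> as
      \<open>u (s + 0)\<close>, so the preimage of \<open>L s (s + t)\<close> under \<open>T\<close>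
      is \<open>L 0 t\<close>.\<close>
    then show ?thesis
      using T(2)[of _ 0] T(2)[of _ t] by (simp add: h_def L_def)
  qed
  have add: "h (x + y) = h x + h y" if xy: "0 \<le> x" "0 \<le> y" "x + y \<le> pi" for x y
  proof (cases "x = 0 \<or> y = 0")
    case True
    moreover have "L 0 0 = {}" by (auto simp: L_def)
    ultimately show ?thesis by (auto simp: h_def)
  next
    case False
    \<comment> \<open>Excluding zero angles also excludes \<open>pi\<close>, since the sum is at
      most \<open>pi\<close>; hence \<open>sin x\<close> and \<open>sin y\<close> are strictly
      positive.\<close>
    then have pos: "x > 0" "y > 0" "x < pi" "y < pi" using xy by auto
    have sx: "sin x > 0" and sy: "sin y > 0" using pos by (auto intro: sin_gt_zero)
    have sxy: "sin (x + y) \<ge> 0" using xy by (intro sin_ge_zero) auto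
    \<comment> \<open>The middle vector is, up to the nonnegative factor \<open>sin (x + y)\<close>,
      a positive combination of the outer two. This decides the signs when the large lune is cut in
      two.\<close>
    have comb: "sin (x + y) * (a \<bullet> u x) = sin y * (a \<bullet> u 0) + sin x * (a \<bullet> u (x + y))" for a
    proof -
      have "sin y = sin (x + y) * cos x - cos (x + y) * sin x"
        using sin_diff[of "x + y" x] by simp
      then show ?thesis
        by (simp only: \<open>sin y = _\<close> u_def) (simp add: inner_simps algebra_simps)
    qed
    have "prob (L 0 (x + y)) = prob (L 0 x \<union> L x (x + y))"
    proof (rule finite_measure_eq_AE)
      have "AE a in unif_sphere. a \<bullet> u 0 \<noteq> 0 \<and> a \<bullet> u x \<noteq> 0 \<and> a \<bullet> u (x + y) \<noteq> 0"
        using AE_unif_sphere_inner_neq_0[OF u_neq_0[of 0]] AE_unif_sphere_inner_neq_0[OF u_neq_0[of x]]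
          AE_unif_sphere_inner_neq_0[OF u_neq_0[of "x + y"]]
        by eventually_elim auto
      then show "AE a in unif_sphere. a \<in> L 0 (x + y) \<longleftrightarrow> a \<in> L 0 x \<union> L x (x + y)"
      proof eventually_elim
        case (elim a)
        have "a \<bullet> u (x + y) > 0" if "a \<bullet> u 0 < 0" "a \<bullet> u x > 0"
        proof -
          have "sin y * (a \<bullet> u 0) < 0" "0 \<le> sin (x + y) * (a \<bullet> u x)"
            using that sy sxy by (auto simp: mult_pos_neg)
          then have "0 < sin x * (a \<bullet> u (x + y))" using comb[of a] by linarith
          then show ?thesis using sx by (simp add: zero_less_mult_iff)
        qed
        moreover have "a \<bullet> u 0 < 0" if "a \<bullet> u x < 0" "a \<bullet> u (x + y) > 0"
        proof -
          have "sin x * (a \<bullet> u (x + y)) > 0" "sin (x + y) * (a \<bullet> u x) \<le> 0"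
            using that sx sxy by (auto simp: mult_nonneg_nonpos)
          then have "sin y * (a \<bullet> u 0) < 0" using comb[of a] by linarith
          then show ?thesis using sy by (simp add: mult_less_0_iff)
        qed
        ultimately show ?case using elim unfolding L_def
          by (smt (verit) UnE UnI1 UnI2 mem_Collect_eq)
      qed
    qed measurable
    also have "\<dots> = prob (L 0 x) + prob (L x (x + y))"
    proof (rule finite_measure_Union)
      show "L 0 x \<inter> L x (x + y) = {}" by (auto simp: L_def)
    qed measurable
    finally show ?thesis by (simp add: rot) (simp add: h_def)
  qed
  \<comment> \<open>As \<open>u pi = - e\<close>, the second condition becomes
    \<open>a \<bullet> e < 0\<close>, which differs from the first by a null set.\<close>
  have "h pi = prob {a \<in> space unif_sphere. a \<bullet> e \<le> 0}"
    unfolding h_def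
  proof (rule finite_measure_eq_AE)
    have "e \<noteq> 0" using e by auto
    from AE_unif_sphere_inner_neq_0[OF this]
    show "AE a in unif_sphere. a \<in> L 0 pi \<longleftrightarrow> a \<in> {a \<in> space unif_sphere. a \<bullet> e \<le> 0}"
      by eventually_elim (auto simp: L_def u0 upi)
  qed measurable
  also have "\<dots> = 1/2" using e by (intro measure_unif_sphere_halfspace) auto
  finally have "h pi = 1/2" .
  have "h t = t / pi * h pi"
    by (rule nonneg_additive_linear) (use t add in \<open>auto simp: h_def\<close>)
  then have "h t = t / (2 * pi)" unfolding \<open>h pi = 1/2\<close> by simp
  then show ?thesis by (simp add: h_def L_def u_def)
qed

text \<open>The half-space \<open>a \<bullet> U \<le> 0\<close>, of mass \<open>1/2\<close>, is the
  disjoint union of the wedge and a lune of opening \<open>Ang U V\<close>. The lune is put into the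
  standard position by Gram-Schmidt.\<close>

lemma measure_unif_sphere_wedge:
  fixes U V :: "'a::euclidean_space"
  assumes U: "U \<noteq> 0" and V: "V \<noteq> 0"
  shows "measure unif_sphere {a \<in> space unif_sphere. a \<bullet> U \<le> 0 \<and> a \<bullet> V \<le> 0}
       = 1/2 - 1 / (2 * pi) * Ang U V"
proof -
  interpret prob_space "unif_sphere :: 'a measure" by (rule prob_space_unif_sphere)
  \<comment> \<open>Here \<open>e\<close> is the direction of \<open>U\<close>, \<open>w\<close> the
    part of \<open>V\<close> orthogonal to it and \<open>c\<close> the cosine of the angle. If
    \<open>U\<close> and \<open>V\<close> are parallel, then \<open>w = 0\<close> and
    \<open>f = sgn 0 = 0\<close>, and the decomposition of \<open>V\<close> below still
    holds.\<close>
  define e where "e = sgn U"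
  define w where "w = V - (V \<bullet> e) *\<^sub>R e"
  define f where "f = sgn w"
  define c where "c = (V \<bullet> e) / norm V"
  have e: "norm e = 1" using U by (simp add: e_def norm_sgn)
  then have ee: "e \<bullet> e = 1" by (simp add: norm_eq_1)
  have eU: "a \<bullet> U = norm U * (a \<bullet> e)" for a using U by (simp add: e_def sgn_div_norm)
  have we: "w \<bullet> e = 0" by (simp add: w_def inner_simps ee)
  have c: "Ang U V = arccos c" "-1 \<le> c" "c \<le> 1"
  proof -
    show "Ang U V = arccos c" using U V
      by (simp add: Ang_def c_def e_def sgn_div_norm inner_commute field_simps)
    have "\<bar>V \<bullet> e\<bar> \<le> norm V" using Cauchy_Schwarz_ineq2[of V e] e by simp
    then show "-1 \<le> c" "c \<le> 1" using V by (auto simp: c_def field_simps abs_le_iff)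
  qed
  have V_eq: "V = (norm V * c) *\<^sub>R e + norm w *\<^sub>R f"
  proof -
    have "norm w *\<^sub>R f = w" by (cases "w = 0") (simp_all add: f_def sgn_div_norm)
    then show ?thesis using V by (simp add: c_def w_def)
  qed
  have "(norm V)\<^sup>2 = (norm V * c)\<^sup>2 + (norm w)\<^sup>2"
  proof -
    have "V \<bullet> V = ((V \<bullet> e) *\<^sub>R e + w) \<bullet> ((V \<bullet> e) *\<^sub>R e + w)" by (simp add: w_def)
    also have "\<dots> = (V \<bullet> e)\<^sup>2 + w \<bullet> w"
      by (simp add: inner_simps ee we inner_commute[of e w] power2_eq_square)
    finally show ?thesis using V by (simp add: c_def power2_norm_eq_inner)
  qed
  then have "(norm w)\<^sup>2 = (norm V * sin (arccos c))\<^sup>2"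
    using c by (simp add: sin_arccos power_mult_distrib abs_square_le_1 abs_le_iff algebra_simps)
  \<comment> \<open>The root has the right sign because \<open>arccos c\<close> lies between
    \<open>0\<close> and \<open>pi\<close>, where the sine is nonnegative.\<close>
  then have w_sin: "norm w = norm V * sin (arccos c)"
    using c by (subst (asm) power2_eq_iff_nonneg) (auto intro!: mult_nonneg_nonneg sin_ge_zero simp: arccos_lbound arccos_ubound)
  have aV: "a \<bullet> V = norm V * (a \<bullet> (cos (arccos c) *\<^sub>R e + sin (arccos c) *\<^sub>R f))" for a
    by (subst V_eq) (simp add: w_sin inner_simps c algebra_simps)
  have lune: "prob {a \<in> space unif_sphere. a \<bullet> U \<le> 0 \<and> a \<bullet> V > 0} = arccos c / (2 * pi)"
  proof (cases "w = 0")
    case False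
    then have "norm f = 1" "e \<bullet> f = 0" using we by (simp_all add: f_def norm_sgn sgn_div_norm inner_commute)
    from measure_unif_sphere_lune[OF e this, of "arccos c"]
    show ?thesis using U V c unfolding eU aV
      by (simp add: mult_le_0_iff zero_less_mult_iff arccos_lbound arccos_ubound)
  next
    \<comment> \<open>Parallel vectors leave no unit vector \<open>f\<close> to span a plane with
      \<open>e\<close>. For \<open>c = 1\<close> the lune is empty; for \<open>c = -1\<close> it is
      the half-space up to a null set.\<close>
    case True
    then have "sin (arccos c) = 0" using w_sin V by simp
    then have "c\<^sup>2 = 1" using c by (simp add: sin_arccos abs_square_le_1 abs_le_iff)
    then consider "c = 1" | "c = -1" by (auto simp: power2_eq_1_iff)
    then show ?thesis
    proof cases
      case 1
      then have "{a \<in> space unif_sphere. a \<bullet> U \<le> 0 \<and> a \<bullet> V > 0} = {}"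
        using U V unfolding eU aV by (auto simp: mult_le_0_iff zero_less_mult_iff)
      with 1 show ?thesis by (simp only: measure_empty arccos_1 div_0)
    next
      case 2
      have "prob {a \<in> space unif_sphere. a \<bullet> U \<le> 0 \<and> a \<bullet> V > 0}
          = prob {a \<in> space unif_sphere. a \<bullet> U \<le> 0}"
      proof (rule finite_measure_eq_AE)
        show "AE a in unif_sphere. a \<in> {a \<in> space unif_sphere. a \<bullet> U \<le> 0 \<and> a \<bullet> V > 0}
          \<longleftrightarrow> a \<in> {a \<in> space unif_sphere. a \<bullet> U \<le> 0}"
          using AE_unif_sphere_inner_neq_0[OF U]
          by eventually_elim (use U V 2 in \<open>auto simp: eU aV mult_le_0_iff mult_less_0_iff\<close>)
      qed measurable
      with 2 show ?thesis by (simp only: measure_unif_sphere_halfspace[OF U]) simp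
    qed
  qed
  have "prob {a \<in> space unif_sphere. a \<bullet> U \<le> 0}
      = prob ({a \<in> space unif_sphere. a \<bullet> U \<le> 0 \<and> a \<bullet> V \<le> 0} \<union> {a \<in> space unif_sphere. a \<bullet> U \<le> 0 \<and> a \<bullet> V > 0})"
    by (rule arg_cong[where f = prob]) auto
  also have "\<dots> = prob {a \<in> space unif_sphere. a \<bullet> U \<le> 0 \<and> a \<bullet> V \<le> 0}
      + prob {a \<in> space unif_sphere. a \<bullet> U \<le> 0 \<and> a \<bullet> V > 0}"
  proof (rule finite_measure_Union)
    show "{a \<in> space unif_sphere. a \<bullet> U \<le> 0 \<and> a \<bullet> V \<le> 0}
        \<inter> {a \<in> space unif_sphere. a \<bullet> U \<le> 0 \<and> a \<bullet> V > 0} = {}" by auto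
  qed measurable
  finally show ?thesis
    by (simp only: lune measure_unif_sphere_halfspace[OF U] c(1)) simp
qed

section \<open>Independent copies and products of distribution functions\<close>

text \<open>Unconditional, so usable as a rewrite rule: if the set is not measurable or has infinite
  measure, both sides take the default value 0.\<close>

lemma integral_of_bool:
  "(\<integral>z. of_bool (R z) \<partial>N) = (measure N {z \<in> space N. R z} :: real)"
proof -
  have "(\<integral>z. of_bool (R z) \<partial>N) = (\<integral>z. indicator {z \<in> space N. R z} z \<partial>N :: real)"
    by (intro Bochner_Integration.integral_cong) (auto simp: indicator_def)
  then show ?thesis by (simp add: Int_absorb2)
qed

text \<open>Given \<open>Z i\<close> and \<open>Z j\<close>, the events for different
  \<open>k\<close> concern different copies and are independent, so their conditional probabilities
  multiply. Formally, the joint law is a product measure and Fubini integrates out the coordinates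
  in \<open>K\<close> first.\<close>

lemma (in prob_space) prob_iid_conditional:
  fixes Z :: "'i \<Rightarrow> 'a \<Rightarrow> 'b"
  assumes indep: "indep_vars (\<lambda>_. S) Z (insert i (insert j K))"
    and law: "\<And>k. k \<in> insert i (insert j K) \<Longrightarrow> distr M S (Z k) = Q"
    and K: "finite K" "i \<notin> K" "j \<notin> K" "i \<noteq> j"
    and R: "\<And>k. k \<in> K \<Longrightarrow> Measurable.pred (S \<Otimes>\<^sub>M S \<Otimes>\<^sub>M S) (\<lambda>(x, y, z). R k x y z)"
  shows "prob {\<omega> \<in> space M. \<forall>k\<in>K. R k (Z i \<omega>) (Z j \<omega>) (Z k \<omega>)}
       = (\<integral>(x, y). (\<Prod>k\<in>K. measure Q {z \<in> space Q. R k x y z}) \<partial>(Q \<Otimes>\<^sub>M Q))"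
proof -
  let ?I = "insert i (insert j K)"
  have rv: "random_variable S (Z k)" if "k \<in> ?I" for k
    using indep that unfolding indep_vars_def by auto
  have Q: "prob_space Q" using law[of i] prob_space_distr[OF rv[of i]] by simp
  interpret Q: prob_space Q by fact
  have sets_Q [measurable_cong]: "sets Q = sets S" using law[of i] by (metis insertI1 sets_distr)
  have space_Q: "space Q = space S" using sets_eq_imp_space_eq[OF sets_Q] .
  interpret product_sigma_finite "\<lambda>_. Q" by standard
  interpret QQ: pair_prob_space Q Q ..
  note R [measurable]
  have R': "Measurable.pred N (\<lambda>w. R k (f w) (g w) (h w))"
    if "k \<in> K" "f \<in> N \<rightarrow>\<^sub>M S" "g \<in> N \<rightarrow>\<^sub>M S" "h \<in> N \<rightarrow>\<^sub>M S" for k f g h N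
    using measurable_compose[OF measurable_Pair[OF that(2) measurable_Pair[OF that(3,4)]] R[OF that(1)]]
    by simp
  define q where "q x y k = measure Q {z \<in> space Q. R k x y z}" for x y k
  have q_meas: "(\<lambda>(x, y). \<Prod>k\<in>K. q x y k) \<in> borel_measurable (Q \<Otimes>\<^sub>M Q)"
  proof -
    have "(\<lambda>p. q (fst p) (snd p) k) \<in> borel_measurable (Q \<Otimes>\<^sub>M Q)" if k: "k \<in> K" for k
    proof -
      have "Measurable.pred ((Q \<Otimes>\<^sub>M Q) \<Otimes>\<^sub>M Q) (\<lambda>w. R k (fst (fst w)) (snd (fst w)) (snd w))"
        by (intro R'[OF k]) measurable
      then have "(\<lambda>p. \<integral>z. (of_bool (R k (fst p) (snd p) z) :: real) \<partial>Q) \<in> borel_measurable (Q \<Otimes>\<^sub>M Q)"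
        by (intro Q.borel_measurable_lebesgue_integral) (simp add: case_prod_beta)
      moreover have "(\<integral>z. (of_bool (R k (fst p) (snd p) z) :: real) \<partial>Q) = q (fst p) (snd p) k" for p
        by (simp add: integral_of_bool q_def)
      ultimately show ?thesis by simp
    qed
    then show ?thesis unfolding case_prod_beta by (intro borel_measurable_prod)
  qed
  have q_bd: "norm (\<Prod>k\<in>K. q x y k) \<le> 1" for x y
    unfolding q_def by (auto simp: abs_prod intro!: prod_le_1)
  \<comment> \<open>The indicator of the intersection, written as a product so that it factors over
    the coordinates in \<open>K\<close>.\<close>
  define F where "F x = (\<Prod>k\<in>K. indicator {z. R k (x i) (x j) z} (x k) :: real)" for x
  have F_meas [measurable]: "F \<in> borel_measurable (Pi\<^sub>M ?I (\<lambda>_. Q))"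
  proof -
    have "Measurable.pred (Pi\<^sub>M ?I (\<lambda>_. Q)) (\<lambda>x. R k (x i) (x j) (x k))" if "k \<in> K" for k
      using that by (intro R') (auto intro: measurable_component_singleton simp: measurable_cong_sets[OF refl sets_Q[symmetric]])
    then show ?thesis
      unfolding F_def indicator_def by (intro borel_measurable_prod) auto
  qed
  have F_bd: "norm (F x) \<le> 1" for x
    unfolding F_def by (auto simp: abs_prod intro!: prod_le_1)
  interpret PI: prob_space "Pi\<^sub>M ?I (\<lambda>_. Q)" by (rule prob_space_PiM) (rule Q)
  have F_int: "integrable (Pi\<^sub>M ?I (\<lambda>_. Q)) F"
    by (rule PI.integrable_const_bound[where B = 1]) (use F_bd in auto)
  have distr_eq: "distr M (Pi\<^sub>M ?I (\<lambda>_. S)) (\<lambda>\<omega>. \<lambda>k\<in>?I. Z k \<omega>) = Pi\<^sub>M ?I (\<lambda>_. Q)"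
  proof -
    have "distr M (Pi\<^sub>M ?I (\<lambda>_. S)) (\<lambda>\<omega>. \<lambda>k\<in>?I. Z k \<omega>) = Pi\<^sub>M ?I (\<lambda>k. distr M S (Z k))"
      using indep by (subst (asm) indep_vars_iff_distr_eq_PiM') (auto simp: rv)
    also have "\<dots> = Pi\<^sub>M ?I (\<lambda>_. Q)"
      by (intro PiM_cong refl law)
    finally show ?thesis .
  qed
  have "prob {\<omega> \<in> space M. \<forall>k\<in>K. R k (Z i \<omega>) (Z j \<omega>) (Z k \<omega>)}
      = expectation (\<lambda>\<omega>. F (\<lambda>k\<in>?I. Z k \<omega>))"
    unfolding integral_of_bool[symmetric]
    by (intro Bochner_Integration.integral_cong)
       (auto simp: F_def indicator_def K intro!: prod.neutral split: if_splits)
  also have "\<dots> = integral\<^sup>L (Pi\<^sub>M ?I (\<lambda>_. Q)) F"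
    unfolding distr_eq[symmetric]
    by (subst integral_distr) 
       (use F_meas in \<open>auto simp: rv measurable_cong_sets[OF sets_PiM_cong[OF refl sets_Q] refl] intro!: measurable_restrict\<close>)
  also have "\<dots> = integral\<^sup>L (Pi\<^sub>M ({i, j} \<union> K) (\<lambda>_. Q)) F" by simp
  \<comment> \<open>The coordinates \<open>i\<close> and \<open>j\<close> are held fixed while those
    in \<open>K\<close> are integrated out.\<close>
  also have "\<dots> = (\<integral>x. (\<integral>y. F (merge {i, j} K (x, y)) \<partial>Pi\<^sub>M K (\<lambda>_. Q)) \<partial>Pi\<^sub>M {i, j} (\<lambda>_. Q))"
    using K F_int by (intro product_integral_fold) auto
  also have "\<dots> = (\<integral>x. (\<Prod>k\<in>K. q (x i) (x j) k) \<partial>Pi\<^sub>M {i, j} (\<lambda>_. Q))"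
  proof (intro Bochner_Integration.integral_cong refl)
    fix x assume "x \<in> space (Pi\<^sub>M {i, j} (\<lambda>_. Q))"
    then have x: "x i \<in> space S" "x j \<in> space S" by (auto simp: space_PiM space_Q)
    have [measurable]: "Measurable.pred Q (\<lambda>z. R k (x i) (x j) z)" if "k \<in> K" for k
      using x that by (intro R') (auto simp: space_Q measurable_cong_sets[OF refl sets_Q[symmetric]])
    have "(\<integral>y. F (merge {i, j} K (x, y)) \<partial>Pi\<^sub>M K (\<lambda>_. Q))
        = (\<integral>y. (\<Prod>k\<in>K. indicator {z \<in> space Q. R k (x i) (x j) z} (y k)) \<partial>Pi\<^sub>M K (\<lambda>_. Q))"
      using K by (intro Bochner_Integration.integral_cong refl)
         (auto simp: F_def merge_def indicator_def space_PiM intro!: prod.cong)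
    also have "\<dots> = (\<Prod>k\<in>K. \<integral>z. indicator {z \<in> space Q. R k (x i) (x j) z} z \<partial>Q)"
      by (intro product_integral_prod K(1) integrable_real_indicator)
         (auto simp: Q.emeasure_eq_measure)
    also have "\<dots> = (\<Prod>k\<in>K. q (x i) (x j) k)"
      by (simp add: q_def)
    finally show "(\<integral>y. F (merge {i, j} K (x, y)) \<partial>Pi\<^sub>M K (\<lambda>_. Q)) = (\<Prod>k\<in>K. q (x i) (x j) k)" .
  qed
  \<comment> \<open>The product over the index set \<open>{i, j}\<close> is peeled off one
    coordinate at a time, to reach the binary product \<open>Q \<Otimes>\<^sub>M Q\<close>.\<close>
  also have "\<dots> = (\<integral>w. (\<integral>x. (\<Prod>k\<in>K. q x (w j) k) \<partial>Q) \<partial>Pi\<^sub>M {j} (\<lambda>_. Q))"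
  proof -
    have comp: "(\<lambda>x. x i) \<in> Pi\<^sub>M {i, j} (\<lambda>_. Q) \<rightarrow>\<^sub>M Q" "(\<lambda>x. x j) \<in> Pi\<^sub>M {i, j} (\<lambda>_. Q) \<rightarrow>\<^sub>M Q"
      by (auto intro: measurable_component_singleton)
    have "integrable (Pi\<^sub>M {i, j} (\<lambda>_. Q)) (\<lambda>x. \<Prod>k\<in>K. q (x i) (x j) k)"
    proof -
      interpret Pij: prob_space "Pi\<^sub>M {i, j} (\<lambda>_. Q)" by (rule prob_space_PiM) (rule Q)
      show ?thesis
        using q_bd measurable_compose[OF measurable_Pair[OF comp] q_meas]
        by (intro Pij.integrable_const_bound[where B = 1]) (auto simp: case_prod_beta)
    qed
    then show ?thesis
      using K(4) by (subst product_integral_insert) auto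
  qed
  also have "\<dots> = (\<integral>y. \<integral>x. (\<Prod>k\<in>K. q x y k) \<partial>Q \<partial>Q)"
  proof (rule product_integral_singleton)
    show "(\<lambda>y. \<integral>x. (\<Prod>k\<in>K. q x y k) \<partial>Q) \<in> borel_measurable Q"
      using measurable_pair_swap[OF q_meas]
      by (intro Q.borel_measurable_lebesgue_integral) (simp add: case_prod_beta)
  qed
  also have "\<dots> = (\<integral>(x, y). (\<Prod>k\<in>K. q x y k) \<partial>(Q \<Otimes>\<^sub>M Q))"
    using q_bd q_meas
    by (intro QQ.integral_snd QQ.P.integrable_const_bound[where B = 1]) (auto simp: case_prod_beta)
  finally show ?thesis unfolding q_def .
qed

text \<open>The square expands into
  \<open>J\<^sup>2 + A\<^sup>2 * B\<^sup>2 - 2 * J * A * B\<close>, evaluated at \<open>a\<close> of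
  one observation and \<open>b\<close> of an independent one. Each factor is the probability of an
  event about one further copy, so each product is the probability of an intersection.\<close>

lemma (in prob_space) iid_dependence_expansion:
  fixes Z :: "nat \<Rightarrow> 'a \<Rightarrow> 'b" and a b :: "'b \<Rightarrow> real"
  assumes indep: "indep_vars (\<lambda>_. S) Z {1..6}"
    and law: "\<And>k. k \<in> {1..6} \<Longrightarrow> distr M S (Z k) = Q"
    and a [measurable]: "a \<in> borel_measurable S" and b [measurable]: "b \<in> borel_measurable S"
  shows "(\<integral>(u, v). (measure Q {z \<in> space Q. a z \<le> u \<and> b z \<le> v}
            - measure Q {z \<in> space Q. a z \<le> u} * measure Q {z \<in> space Q. b z \<le> v})\<^sup>2
          \<partial>(distr Q borel a \<Otimes>\<^sub>M distr Q borel b))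
    = prob {\<omega> \<in> space M. (a (Z 1 \<omega>) \<le> a (Z 3 \<omega>) \<and> a (Z 2 \<omega>) \<le> a (Z 3 \<omega>))
          \<and> (b (Z 1 \<omega>) \<le> b (Z 4 \<omega>) \<and> b (Z 2 \<omega>) \<le> b (Z 4 \<omega>))}
    + prob {\<omega> \<in> space M. (a (Z 1 \<omega>) \<le> a (Z 5 \<omega>) \<and> a (Z 2 \<omega>) \<le> a (Z 5 \<omega>))
          \<and> (b (Z 3 \<omega>) \<le> b (Z 6 \<omega>) \<and> b (Z 4 \<omega>) \<le> b (Z 6 \<omega>))}
    - 2 * prob {\<omega> \<in> space M. (a (Z 1 \<omega>) \<le> a (Z 4 \<omega>) \<and> a (Z 2 \<omega>) \<le> a (Z 4 \<omega>))
          \<and> (b (Z 1 \<omega>) \<le> b (Z 5 \<omega>) \<and> b (Z 3 \<omega>) \<le> b (Z 5 \<omega>))}"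
proof -
  have rv: "random_variable S (Z 1)"
    using indep unfolding indep_vars_def by auto
  have Q: "prob_space Q" using law[of 1] prob_space_distr[OF rv] by simp
  interpret Q: prob_space Q by fact
  have sets_Q [measurable_cong]: "sets Q = sets S" using law[of 1] by auto
  interpret QQ: pair_prob_space Q Q ..
  define J where "J u v = measure Q {z \<in> space Q. a z \<le> u \<and> b z \<le> v}" for u v
  define A where "A u = measure Q {z \<in> space Q. a z \<le> u}" for u
  define B where "B v = measure Q {z \<in> space Q. b z \<le> v}" for v
  have J_eq: "J u v = (\<integral>z. of_bool (a z \<le> u \<and> b z \<le> v) \<partial>Q)" for u v
    by (simp add: integral_of_bool J_def)
  have [measurable]: "(\<lambda>(u, v). J u v) \<in> borel_measurable (borel \<Otimes>\<^sub>M borel)"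
    unfolding J_eq case_prod_beta
    by (intro Q.borel_measurable_lebesgue_integral) measurable
  have A_mono: "mono A" and B_mono: "mono B"
    unfolding mono_def A_def B_def by (auto intro!: Q.finite_measure_mono)
  have [measurable]: "A \<in> borel_measurable borel" "B \<in> borel_measurable borel"
    using A_mono B_mono by (auto intro: borel_measurable_mono)
  have bd: "0 \<le> J u v" "J u v \<le> 1" "0 \<le> A u" "A u \<le> 1" "0 \<le> B v" "B v \<le> 1" for u v
    by (simp_all add: J_def A_def B_def)
  have int: "integrable (Q \<Otimes>\<^sub>M Q) f"
    if "f \<in> borel_measurable (Q \<Otimes>\<^sub>M Q)" "\<And>p. 0 \<le> f p \<and> f p \<le> 1" for f :: "_ \<Rightarrow> real"
    by (rule QQ.P.integrable_const_bound[where B = 1]) (use that in auto)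
  have "(\<integral>(u, v). (J u v - A u * B v)\<^sup>2 \<partial>(distr Q borel a \<Otimes>\<^sub>M distr Q borel b))
      = (\<integral>(x, y). (J (a x) (b y) - A (a x) * B (b y))\<^sup>2 \<partial>(Q \<Otimes>\<^sub>M Q))"
  proof -
    have "distr Q borel a \<Otimes>\<^sub>M distr Q borel b
        = distr (Q \<Otimes>\<^sub>M Q) (borel \<Otimes>\<^sub>M borel) (\<lambda>(x, y). (a x, b y))"
      by (intro pair_measure_distr prob_space_imp_sigma_finite Q.prob_space_distr) measurable
    then show ?thesis
      by (simp add: integral_distr case_prod_unfold)
  qed
  also have "\<dots> = (\<integral>(x, y). (J (a x) (b y))\<^sup>2 + (A (a x))\<^sup>2 * (B (b y))\<^sup>2
                - 2 * (J (a x) (b y) * A (a x) * B (b y)) \<partial>(Q \<Otimes>\<^sub>M Q))"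
    by (intro Bochner_Integration.integral_cong) (auto simp: power2_eq_square algebra_simps)
  also have "\<dots> = (\<integral>(x, y). (J (a x) (b y))\<^sup>2 \<partial>(Q \<Otimes>\<^sub>M Q))
      + (\<integral>(x, y). (A (a x))\<^sup>2 * (B (b y))\<^sup>2 \<partial>(Q \<Otimes>\<^sub>M Q))
      - 2 * (\<integral>(x, y). J (a x) (b y) * A (a x) * B (b y) \<partial>(Q \<Otimes>\<^sub>M Q))"
  proof -
    have "integrable (Q \<Otimes>\<^sub>M Q) (\<lambda>p. (J (a (fst p)) (b (snd p)))\<^sup>2)"
      by (rule int, measurable) (use bd in \<open>auto intro!: mult_le_one power_le_one\<close>)
    moreover have "integrable (Q \<Otimes>\<^sub>M Q) (\<lambda>p. (A (a (fst p)))\<^sup>2 * (B (b (snd p)))\<^sup>2)"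
      by (rule int, measurable) (use bd in \<open>auto intro!: mult_le_one power_le_one\<close>)
    moreover have "integrable (Q \<Otimes>\<^sub>M Q) (\<lambda>p. J (a (fst p)) (b (snd p)) * A (a (fst p)) * B (b (snd p)))"
      by (rule int, measurable) (use bd in \<open>auto intro!: mult_le_one power_le_one\<close>)
    ultimately show ?thesis by (simp add: case_prod_unfold)
  qed
  \<comment> \<open>Copies 1 and 2 supply the two factors \<open>J\<close>; \<open>Z 3\<close> and
    \<open>Z 4\<close> supply the evaluation points.\<close>
  also have "(\<integral>(x, y). (J (a x) (b y))\<^sup>2 \<partial>(Q \<Otimes>\<^sub>M Q))
    = prob {\<omega> \<in> space M. \<forall>k\<in>{1, 2}. a (Z k \<omega>) \<le> a (Z 3 \<omega>) \<and> b (Z k \<omega>) \<le> b (Z 4 \<omega>)}"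
    by (subst prob_iid_conditional[where S = S and Q = Q and R = "\<lambda>k x y z. a z \<le> a x \<and> b z \<le> b y"])
       (auto intro!: indep_vars_subset[OF indep] law simp: J_def power2_eq_square)
  \<comment> \<open>Copies 1 and 2 supply the factors \<open>A\<close>, copies 3 and 4 the factors
    \<open>B\<close>; the evaluation points come from \<open>Z 5\<close> and
    \<open>Z 6\<close>.\<close>
  also have "(\<integral>(x, y). (A (a x))\<^sup>2 * (B (b y))\<^sup>2 \<partial>(Q \<Otimes>\<^sub>M Q))
    = prob {\<omega> \<in> space M. \<forall>k\<in>{1, 2, 3, 4}. if k \<le> 2 then a (Z k \<omega>) \<le> a (Z 5 \<omega>) else b (Z k \<omega>) \<le> b (Z 6 \<omega>)}"
    by (subst prob_iid_conditional[where S = S and Q = Q and R = "\<lambda>k x y z. if k \<le> 2 then a z \<le> a x else b z \<le> b y"])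
       (auto intro!: indep_vars_subset[OF indep] law simp: A_def B_def power2_eq_square mult_ac)
  \<comment> \<open>Copy 1 is tested on both coordinates and gives \<open>J\<close>, copy 2 gives
    \<open>A\<close> and copy 3 gives \<open>B\<close>; the evaluation points come from
    \<open>Z 4\<close> and \<open>Z 5\<close>.\<close>
  also have "(\<integral>(x, y). J (a x) (b y) * A (a x) * B (b y) \<partial>(Q \<Otimes>\<^sub>M Q))
    = prob {\<omega> \<in> space M. \<forall>k\<in>{1, 2, 3}. (k \<le> 2 \<longrightarrow> a (Z k \<omega>) \<le> a (Z 4 \<omega>)) \<and> (k \<noteq> 2 \<longrightarrow> b (Z k \<omega>) \<le> b (Z 5 \<omega>))}"
    by (subst prob_iid_conditional[where S = S and Q = Q and R = "\<lambda>k x y z. (k \<le> 2 \<longrightarrow> a z \<le> a x) \<and> (k \<noteq> 2 \<longrightarrow> b z \<le> b y)"])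
       (auto intro!: indep_vars_subset[OF indep] law simp: J_def A_def B_def mult_ac)
  finally show ?thesis
    unfolding J_def A_def B_def by (simp add: conj_ac)
qed

section \<open>Fubini over the directions, absence of ties, distribution functions as
  measures\<close>

text \<open>Two applications of Fubini to bounded functions: for fixed \<open>\<omega>\<close> one
  condition involves only \<open>a\<close> and the other only \<open>b\<close>, so the masses
  multiply. The integrability claims serve to split sums under the iterated integral.\<close>

lemma integral_prob_conj:
  fixes U :: "'a measure" and V :: "'b measure" and M :: "'w measure"
  assumes U: "prob_space U" and V: "prob_space V" and M: "prob_space M"
    and A: "Measurable.pred (U \<Otimes>\<^sub>M M) (\<lambda>(a, \<omega>). A a \<omega>)"
    and B: "Measurable.pred (V \<Otimes>\<^sub>M M) (\<lambda>(b, \<omega>). B b \<omega>)"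
  defines "G \<equiv> \<lambda>a b. measure M {\<omega> \<in> space M. A a \<omega> \<and> B b \<omega>}"
  shows "a \<in> space U \<Longrightarrow> integrable V (G a)"
    and "integrable U (\<lambda>a. \<integral>b. G a b \<partial>V)"
    and "(\<integral>a. \<integral>b. G a b \<partial>V \<partial>U)
       = (\<integral>\<omega>. measure U {a \<in> space U. A a \<omega>} * measure V {b \<in> space V. B b \<omega>} \<partial>M)"
proof -
  interpret U: prob_space U by fact
  interpret V: prob_space V by fact
  interpret M: prob_space M by fact
  interpret UM: pair_prob_space U M ..
  interpret VM: pair_prob_space V M ..
  note A [measurable] B [measurable]
  have A_fix [measurable]: "Measurable.pred M (A a)" if "a \<in> space U" for a
    using measurable_compose[OF measurable_Pair1'[OF that] A] by simp
  define v where "v \<omega> = (\<integral>b. of_bool (B b \<omega>) \<partial>V :: real)" for \<omega>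
  define g where "g a b \<omega> = (of_bool (A a \<omega>) * of_bool (B b \<omega>) :: real)" for a b \<omega>
  have v_meas [measurable]: "v \<in> borel_measurable M"
    unfolding v_def using B
    by (intro V.borel_measurable_lebesgue_integral) (simp add: case_prod_unfold)
  have v_bd: "0 \<le> v \<omega>" "v \<omega> \<le> 1" for \<omega>
    by (simp_all add: v_def integral_of_bool)
  have G_eq: "G a b = (\<integral>\<omega>. g a b \<omega> \<partial>M)" for a b
    by (simp add: G_def g_def integral_of_bool flip: of_bool_conj)
  have g_int: "integrable (V \<Otimes>\<^sub>M M) (\<lambda>(b, \<omega>). g a b \<omega>)" if a: "a \<in> space U" for a
    using A_fix[OF a] unfolding g_def
    by (intro VM.P.integrable_const_bound[where B = 1]) auto
  \<comment> \<open>The condition on \<open>a\<close> is constant in \<open>b\<close>; integrating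
    \<open>b\<close> out first leaves only the mass \<open>v \<omega>\<close>.\<close>
  have inner: "(\<integral>b. G a b \<partial>V) = (\<integral>\<omega>. of_bool (A a \<omega>) * v \<omega> \<partial>M)" if "a \<in> space U" for a
    unfolding G_eq by (subst VM.Fubini_integral[symmetric, OF g_int[OF that]]) (simp add: g_def v_def)
  have v_int: "integrable (U \<Otimes>\<^sub>M M) (\<lambda>(a, \<omega>). of_bool (A a \<omega>) * v \<omega>)"
    using v_bd by (intro UM.P.integrable_const_bound[where B = 1]) auto
  show "integrable V (G a)" if "a \<in> space U"
    unfolding G_eq using VM.integrable_fst[OF g_int[OF that]] .
  show "integrable U (\<lambda>a. \<integral>b. G a b \<partial>V)"
    using UM.integrable_fst[OF v_int] by (simp add: inner cong: Bochner_Integration.integrable_cong)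
  have "(\<integral>a. \<integral>b. G a b \<partial>V \<partial>U) = (\<integral>a. \<integral>\<omega>. of_bool (A a \<omega>) * v \<omega> \<partial>M \<partial>U)"
    by (simp add: inner cong: Bochner_Integration.integral_cong)
  also have "\<dots> = (\<integral>\<omega>. (\<integral>a. of_bool (A a \<omega>) * v \<omega> \<partial>U) \<partial>M)"
    by (rule UM.Fubini_integral[symmetric, OF v_int])
  finally show "(\<integral>a. \<integral>b. G a b \<partial>V \<partial>U)
      = (\<integral>\<omega>. measure U {a \<in> space U. A a \<omega>} * measure V {b \<in> space V. B b \<omega>} \<partial>M)"
    by (simp add: v_def integral_of_bool)
qed

text \<open>The index \<open>j\<close> is only a spare one, needed to apply \<open>prob_iid_conditional\<close>.\<close>

lemma (in prob_space) AE_iid_neq: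
  fixes Z :: "nat \<Rightarrow> 'a \<Rightarrow> 'b" and a :: "'b \<Rightarrow> real"
  assumes indep: "indep_vars (\<lambda>_. S) Z I" and law: "\<And>k. k \<in> I \<Longrightarrow> distr M S (Z k) = Q"
    and I: "i \<in> I" "j \<in> I" "k \<in> I" "i \<noteq> j" "i \<noteq> k" "j \<noteq> k"
    and a [measurable]: "a \<in> borel_measurable S"
    and cont: "continuous_on UNIV (cdf (distr Q borel a))"
  shows "AE \<omega> in M. a (Z k \<omega>) \<noteq> a (Z i \<omega>)"
proof -
  have [measurable]: "random_variable S (Z k)" if "k \<in> I" for k
    using indep that unfolding indep_vars_def by auto
  have Q: "prob_space Q" using law[OF I(1)] prob_space_distr[of "Z i" S] I(1) by auto
  interpret Q: prob_space Q by fact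
  have sets_Q [measurable_cong]: "sets Q = sets S" using law[OF I(1)] by (metis sets_distr)
  interpret D: real_distribution "distr Q borel a" by (rule Q.real_distribution_distr) measurable
  \<comment> \<open>The mass of a point is the jump of the distribution function there.\<close>
  have atom: "measure Q {z \<in> space Q. a z = x} = 0" for x
  proof -
    have "measure (distr Q borel a) {x} = 0"
      using cont D.isCont_cdf[of x] by (simp add: continuous_on_eq_continuous_at)
    moreover have "measure (distr Q borel a) {x} = measure Q (a -` {x} \<inter> space Q)"
      by (rule measure_distr) measurable
    moreover have "a -` {x} \<inter> space Q = {z \<in> space Q. a z = x}" by auto
    ultimately show ?thesis by simp
  qed
  \<comment> \<open>Given \<open>Z i\<close>, a tie means that \<open>a (Z k \<omega>)\<close> hits
    a fixed value, an event of probability 0 by \<open>atom\<close>.\<close>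
  have "prob {\<omega> \<in> space M. \<forall>k\<in>{k}. a (Z k \<omega>) = a (Z i \<omega>)} = 0"
    using I
    by (subst prob_iid_conditional[where S = S and Q = Q and j = j and R = "\<lambda>k x y z. a z = a x"])
       (auto intro!: indep_vars_subset[OF indep] law simp: atom case_prod_unfold)
  then show ?thesis
    using I by (subst (asm) prob_Collect_eq_0) (auto simp: eq_commute)
qed

text \<open>Both measures have the same distribution function. This identifies \<open>dF\<close>,
  written as an \<open>interval_measure\<close>, with the law of a projection.\<close>

lemma interval_measure_cdf:
  assumes "real_distribution D"
  shows "interval_measure (cdf D) = D"
proof -
  interpret real_distribution D by fact
  have "real_distribution (interval_measure (cdf D))"
    by (rule real_distribution_interval_measure)
       (auto intro: cdf_nondecreasing cdf_is_right_cont cdf_lim_at_bot cdf_lim_at_top_prob)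
  then show ?thesis
    by (rule cdf_unique[OF _ assms])
       (auto intro!: cdf_interval_measure cdf_nondecreasing cdf_is_right_cont cdf_lim_at_bot)
qed

text \<open>By Cauchy-Schwarz the quotient lies in \<open>[-1, 1]\<close>, also for a zero vector,
  where division yields 0. So \<open>arccos\<close> may be replaced by its continuous extension
  \<open>c\<close> to the whole line.\<close>

lemma borel_measurable_Ang [measurable]:
  fixes f g :: "'a \<Rightarrow> 'b::euclidean_space"
  assumes [measurable]: "f \<in> borel_measurable N" "g \<in> borel_measurable N"
  shows "(\<lambda>x. Ang (f x) (g x)) \<in> borel_measurable N"
proof -
  define c where "c = (\<lambda>t. arccos (max (-1) (min 1 t)))"
  have "Ang u v = c ((u \<bullet> v) / (norm u * norm v))" for u v :: 'b
  proof -
    have "\<bar>u \<bullet> v\<bar> \<le> 1 * (norm u * norm v)"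
      using Cauchy_Schwarz_ineq2[of u v] by simp
    then have "\<bar>(u \<bullet> v) / (norm u * norm v)\<bar> \<le> 1"
      by (auto simp: abs_div divide_le_eq abs_mult)
    then show ?thesis
      by (simp only: Ang_def c_def abs_le_iff) (simp add: max_absorb2 min_absorb2)
  qed
  moreover have "c \<in> borel_measurable borel"
    unfolding c_def by (intro borel_measurable_continuous_onI continuous_intros) auto
  ultimately show ?thesis by simp
qed

section \<open>Assembly: the expansion is integrated over all directions\<close>

theorem theorem7p2:
  fixes M :: "'w measure"
    and P :: "((real ^ 'p) \<times> (real ^ 'q)) measure"
    and X :: "nat \<Rightarrow> 'w \<Rightarrow> real ^ 'p"
    and Y :: "nat \<Rightarrow> 'w \<Rightarrow> real ^ 'q"
  assumes "prob_space M"
    and "prob_space.indep_vars M (\<lambda>_. borel) (\<lambda>i \<omega>. (X i \<omega>, Y i \<omega>)) {1..6}"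
    and "\<And>i. i \<in> {1..6} \<Longrightarrow> distr M borel (\<lambda>\<omega>. (X i \<omega>, Y i \<omega>)) = P"
    and "AE \<alpha> in unif_sphere. continuous_on UNIV (cdf_X P \<alpha>)"
    and "AE \<beta> in unif_sphere. continuous_on UNIV (cdf_Y P \<beta>)"
  shows "(\<integral>\<alpha>. (\<integral>\<beta>. (\<integral>(u, v). (cdf_XY P \<alpha> \<beta> u v - cdf_X P \<alpha> u * cdf_Y P \<beta> v)\<^sup>2
              \<partial>(interval_measure (cdf_X P \<alpha>) \<Otimes>\<^sub>M interval_measure (cdf_Y P \<beta>)))
            \<partial>unif_sphere) \<partial>unif_sphere)
    = (\<integral>\<omega>. (1/2 - 1 / (2 * pi) * Ang (X 1 \<omega> - X 3 \<omega>) (X 2 \<omega> - X 3 \<omega>))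
          * (1/2 - 1 / (2 * pi) * Ang (Y 1 \<omega> - Y 4 \<omega>) (Y 2 \<omega> - Y 4 \<omega>)) \<partial>M)
    + (\<integral>\<omega>. (1/2 - 1 / (2 * pi) * Ang (X 1 \<omega> - X 5 \<omega>) (X 2 \<omega> - X 5 \<omega>))
          * (1/2 - 1 / (2 * pi) * Ang (Y 3 \<omega> - Y 6 \<omega>) (Y 4 \<omega> - Y 6 \<omega>)) \<partial>M)
    - 2 * (\<integral>\<omega>. (1/2 - 1 / (2 * pi) * Ang (X 1 \<omega> - X 4 \<omega>) (X 2 \<omega> - X 4 \<omega>))
          * (1/2 - 1 / (2 * pi) * Ang (Y 1 \<omega> - Y 5 \<omega>) (Y 3 \<omega> - Y 5 \<omega>)) \<partial>M)"
proof -
  interpret M: prob_space M by fact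
  interpret U: prob_space "unif_sphere :: (real ^ 'p) measure" by (rule prob_space_unif_sphere)
  interpret V: prob_space "unif_sphere :: (real ^ 'q) measure" by (rule prob_space_unif_sphere)
  define Z where "Z i \<omega> = (X i \<omega>, Y i \<omega>)" for i \<omega>
  have indep: "M.indep_vars (\<lambda>_. borel) Z {1..6}"
    using assms(2) by (simp add: Z_def[abs_def])
  have law: "distr M borel (Z i) = P" if "i \<in> {1..6}" for i
    using assms(3)[OF that] by (simp add: Z_def[abs_def])
  have Z_meas: "M.random_variable borel (Z i)" if "i \<in> {1..6}" for i
    using indep that unfolding M.indep_vars_def by auto
  have X_meas: "M.random_variable borel (X i)" and Y_meas: "M.random_variable borel (Y i)"
    if "i \<in> {1..6}" for i
    using measurable_compose[OF Z_meas[OF that], of fst borel]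
      measurable_compose[OF Z_meas[OF that], of snd borel]
    by (simp_all add: Z_def borel_measurable_continuous_onI continuous_on_fst continuous_on_snd)
  have law': "P = distr M borel (Z 1)" by (simp add: law)
  interpret P: prob_space P unfolding law' by (rule M.prob_space_distr) (rule Z_meas, simp)
  have sets_P [measurable_cong]: "sets P = sets borel" and space_P: "space P = UNIV"
    by (simp_all add: law')
  have a_meas [measurable]: "(\<lambda>z. \<alpha> \<bullet> fst z) \<in> borel_measurable (borel :: ((real ^ 'p) \<times> (real ^ 'q)) measure)"
    and b_meas [measurable]: "(\<lambda>z. \<beta> \<bullet> snd z) \<in> borel_measurable (borel :: ((real ^ 'p) \<times> (real ^ 'q)) measure)"
    for \<alpha> \<beta>
    by (intro borel_measurable_continuous_onI continuous_intros)+
  have X_law: "cdf_X P \<alpha> = cdf (distr P borel (\<lambda>z. \<alpha> \<bullet> fst z))"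
    and Y_law: "cdf_Y P \<beta> = cdf (distr P borel (\<lambda>z. \<beta> \<bullet> snd z))" for \<alpha> \<beta>
    by (simp_all add: cdf_X_def cdf_Y_def case_prod_unfold)
  have cdf_X_eq: "cdf_X P \<alpha> u = P.prob {z \<in> space P. \<alpha> \<bullet> fst z \<le> u}" for \<alpha> u
    unfolding X_law cdf_def by (subst measure_distr) (auto simp: space_P vimage_def measurable_cong_sets[OF sets_P refl])
  have cdf_Y_eq: "cdf_Y P \<beta> v = P.prob {z \<in> space P. \<beta> \<bullet> snd z \<le> v}" for \<beta> v
    unfolding Y_law cdf_def by (subst measure_distr) (auto simp: space_P vimage_def measurable_cong_sets[OF sets_P refl])
  have cdf_XY_eq: "cdf_XY P \<alpha> \<beta> u v = P.prob {z \<in> space P. \<alpha> \<bullet> fst z \<le> u \<and> \<beta> \<bullet> snd z \<le> v}"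
    for \<alpha> \<beta> u v
    unfolding cdf_XY_def case_prod_unfold
    by (subst measure_distr) (auto simp: space_P vimage_def measurable_cong_sets[OF sets_P refl] borel_prod[symmetric])
  \<comment> \<open>Moving \<open>X k\<close> to the left side turns this into the wedge of the
    differences \<open>X i - X k\<close> and \<open>X j - X k\<close>; the third index marks the
    evaluation point.\<close>
  define A where "A i j k \<alpha> \<omega> \<longleftrightarrow> \<alpha> \<bullet> X i \<omega> \<le> \<alpha> \<bullet> X k \<omega> \<and> \<alpha> \<bullet> X j \<omega> \<le> \<alpha> \<bullet> X k \<omega>" for i j k \<alpha> \<omega>
  define B where "B i j k \<beta> \<omega> \<longleftrightarrow> \<beta> \<bullet> Y i \<omega> \<le> \<beta> \<bullet> Y k \<omega> \<and> \<beta> \<bullet> Y j \<omega> \<le> \<beta> \<bullet> Y k \<omega>" for i j k \<beta> \<omega>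
  define G where "G i j k l m n \<alpha> \<beta> = M.prob {\<omega> \<in> space M. A i j k \<alpha> \<omega> \<and> B l m n \<beta> \<omega>}"
    for i j k l m n \<alpha> \<beta>
  have inner: "(\<integral>(u, v). (cdf_XY P \<alpha> \<beta> u v - cdf_X P \<alpha> u * cdf_Y P \<beta> v)\<^sup>2
              \<partial>(interval_measure (cdf_X P \<alpha>) \<Otimes>\<^sub>M interval_measure (cdf_Y P \<beta>)))
      = G 1 2 3 1 2 4 \<alpha> \<beta> + G 1 2 5 3 4 6 \<alpha> \<beta> - 2 * G 1 2 4 1 3 5 \<alpha> \<beta>" for \<alpha> \<beta>
  proof -
    have "interval_measure (cdf_X P \<alpha>) = distr P borel (\<lambda>z. \<alpha> \<bullet> fst z)"
      "interval_measure (cdf_Y P \<beta>) = distr P borel (\<lambda>z. \<beta> \<bullet> snd z)"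
      unfolding X_law Y_law
      by (simp_all add: interval_measure_cdf measurable_cong_sets[OF sets_P refl] a_meas b_meas)
    then show ?thesis
      using M.iid_dependence_expansion[OF indep law a_meas[of \<alpha>] b_meas[of \<beta>]]
      unfolding cdf_X_eq cdf_Y_eq cdf_XY_eq by (simp add: G_def A_def B_def Z_def)
  qed
  have A_meas: "Measurable.pred (unif_sphere \<Otimes>\<^sub>M M) (\<lambda>(\<alpha>, \<omega>). A i j k \<alpha> \<omega>)"
    if "i \<in> {1..6}" "j \<in> {1..6}" "k \<in> {1..6}" for i j k
  proof -
    note [measurable] = X_meas[OF that(1)] X_meas[OF that(2)] X_meas[OF that(3)]
    show ?thesis unfolding A_def by measurable
  qed
  have B_meas: "Measurable.pred (unif_sphere \<Otimes>\<^sub>M M) (\<lambda>(\<beta>, \<omega>). B i j k \<beta> \<omega>)"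
    if "i \<in> {1..6}" "j \<in> {1..6}" "k \<in> {1..6}" for i j k
  proof -
    note [measurable] = Y_meas[OF that(1)] Y_meas[OF that(2)] Y_meas[OF that(3)]
    show ?thesis unfolding B_def by measurable
  qed
  \<comment> \<open>One of 1, 2, 3 differs from both \<open>i\<close> and \<open>k\<close> and
    serves as the spare index.\<close>
  have third: "\<exists>j\<in>{1..6}. i \<noteq> j \<and> j \<noteq> k" for i k :: nat
    by (rule bexI[of _ "if 1 \<notin> {i, k} then 1 else if 2 \<notin> {i, k} then 2 else 3"]) auto
  have X_neq: "AE \<omega> in M. X i \<omega> \<noteq> X k \<omega>" if ik: "i \<in> {1..6}" "k \<in> {1..6}" "i \<noteq> k" for i k
  proof -
    \<comment> \<open>An almost sure property on a probability space holds for some direction, and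
      one is enough: equal vectors have equal projections.\<close>
    obtain \<alpha> where \<alpha>: "continuous_on UNIV (cdf_X P \<alpha>)"
      using eventually_happens'[OF U.ae_filter_bot assms(4)] by blast
    obtain j where "j \<in> {1..6}" "k \<noteq> j" "j \<noteq> i" using third[of k i] by blast
    then have "AE \<omega> in M. \<alpha> \<bullet> fst (Z i \<omega>) \<noteq> \<alpha> \<bullet> fst (Z k \<omega>)"
      using ik \<alpha> unfolding X_law
      by (intro M.AE_iid_neq[OF indep law, where j = j]) auto
    then show ?thesis by eventually_elim (auto simp: Z_def)
  qed
  have Y_neq: "AE \<omega> in M. Y i \<omega> \<noteq> Y k \<omega>" if ik: "i \<in> {1..6}" "k \<in> {1..6}" "i \<noteq> k" for i k
  proof -
    obtain \<beta> where \<beta>: "continuous_on UNIV (cdf_Y P \<beta>)"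
      using eventually_happens'[OF V.ae_filter_bot assms(5)] by blast
    obtain j where "j \<in> {1..6}" "k \<noteq> j" "j \<noteq> i" using third[of k i] by blast
    then have "AE \<omega> in M. \<beta> \<bullet> snd (Z i \<omega>) \<noteq> \<beta> \<bullet> snd (Z k \<omega>)"
      using ik \<beta> unfolding Y_law
      by (intro M.AE_iid_neq[OF indep law, where j = j]) auto
    then show ?thesis by eventually_elim (auto simp: Z_def)
  qed
  \<comment> \<open>For a zero difference the formula fails: \<open>Ang\<close> becomes
    \<open>arccos 0 = pi / 2\<close> and the right side 1/4, while the set has mass at least
    1/2.\<close>
  have A_wedge: "U.prob {\<alpha> \<in> space unif_sphere. A i j k \<alpha> \<omega>}
      = 1/2 - 1 / (2 * pi) * Ang (X i \<omega> - X k \<omega>) (X j \<omega> - X k \<omega>)"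
    if "X i \<omega> \<noteq> X k \<omega>" "X j \<omega> \<noteq> X k \<omega>" for i j k \<omega>
    using measure_unif_sphere_wedge[of "X i \<omega> - X k \<omega>" "X j \<omega> - X k \<omega>"] that
    by (simp add: A_def inner_diff_right)
  have B_wedge: "V.prob {\<beta> \<in> space unif_sphere. B i j k \<beta> \<omega>}
      = 1/2 - 1 / (2 * pi) * Ang (Y i \<omega> - Y k \<omega>) (Y j \<omega> - Y k \<omega>)"
    if "Y i \<omega> \<noteq> Y k \<omega>" "Y j \<omega> \<noteq> Y k \<omega>" for i j k \<omega>
    using measure_unif_sphere_wedge[of "Y i \<omega> - Y k \<omega>" "Y j \<omega> - Y k \<omega>"] that
    by (simp add: B_def inner_diff_right)
  \<comment> \<open>Only the indices subtracted from one another must differ. The \<open>X\<close>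
    and \<open>Y\<close> indices may overlap, since for fixed \<open>\<omega>\<close> the two
    factors belong to separate direction integrals.\<close>
  have G: "integrable unif_sphere (\<lambda>\<alpha>. \<integral>\<beta>. G i j k l m n \<alpha> \<beta> \<partial>unif_sphere)"
      "\<And>\<alpha>. \<alpha> \<in> space unif_sphere \<Longrightarrow> integrable unif_sphere (G i j k l m n \<alpha>)"
      "(\<integral>\<alpha>. \<integral>\<beta>. G i j k l m n \<alpha> \<beta> \<partial>unif_sphere \<partial>unif_sphere)
      = (\<integral>\<omega>. (1/2 - 1 / (2 * pi) * Ang (X i \<omega> - X k \<omega>) (X j \<omega> - X k \<omega>))
          * (1/2 - 1 / (2 * pi) * Ang (Y l \<omega> - Y n \<omega>) (Y m \<omega> - Y n \<omega>)) \<partial>M)"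
    if idx: "{i, j, k, l, m, n} \<subseteq> {1..6}" and neq: "i \<noteq> k" "j \<noteq> k" "l \<noteq> n" "m \<noteq> n"
    for i j k l m n
  proof -
    have idx': "i \<in> {1..6}" "j \<in> {1..6}" "k \<in> {1..6}" "l \<in> {1..6}" "m \<in> {1..6}" "n \<in> {1..6}"
      using idx by auto
    note A' [measurable] = A_meas[OF idx'(1-3)] and B' [measurable] = B_meas[OF idx'(4-6)]
    note fub = integral_prob_conj[OF U.prob_space_axioms V.prob_space_axioms M.prob_space_axioms A' B',
        folded G_def]
    show "integrable unif_sphere (\<lambda>\<alpha>. \<integral>\<beta>. G i j k l m n \<alpha> \<beta> \<partial>unif_sphere)"
      by (rule fub(2))
    show "integrable unif_sphere (G i j k l m n \<alpha>)" if "\<alpha> \<in> space unif_sphere" for \<alpha>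
      using fub(1)[OF that] by (simp add: G_def[abs_def])
    have meas: "(\<lambda>\<omega>. U.prob {\<alpha> \<in> space unif_sphere. A i j k \<alpha> \<omega>}) \<in> borel_measurable M"
      "(\<lambda>\<omega>. V.prob {\<beta> \<in> space unif_sphere. B l m n \<beta> \<omega>}) \<in> borel_measurable M"
      unfolding integral_of_bool[symmetric]
      by (rule U.borel_measurable_lebesgue_integral V.borel_measurable_lebesgue_integral, measurable)+
    show "(\<integral>\<alpha>. \<integral>\<beta>. G i j k l m n \<alpha> \<beta> \<partial>unif_sphere \<partial>unif_sphere)
      = (\<integral>\<omega>. (1/2 - 1 / (2 * pi) * Ang (X i \<omega> - X k \<omega>) (X j \<omega> - X k \<omega>))
          * (1/2 - 1 / (2 * pi) * Ang (Y l \<omega> - Y n \<omega>) (Y m \<omega> - Y n \<omega>)) \<partial>M)"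
      unfolding fub(3)
    \<comment> \<open>The integrands agree off the null event of ties.\<close>
    proof (rule integral_cong_AE)
      note [measurable] = X_meas[OF idx'(1)] X_meas[OF idx'(2)] X_meas[OF idx'(3)]
        Y_meas[OF idx'(4)] Y_meas[OF idx'(5)] Y_meas[OF idx'(6)]
      show "AE \<omega> in M. U.prob {\<alpha> \<in> space unif_sphere. A i j k \<alpha> \<omega>}
            * V.prob {\<beta> \<in> space unif_sphere. B l m n \<beta> \<omega>}
          = (1/2 - 1 / (2 * pi) * Ang (X i \<omega> - X k \<omega>) (X j \<omega> - X k \<omega>))
          * (1/2 - 1 / (2 * pi) * Ang (Y l \<omega> - Y n \<omega>) (Y m \<omega> - Y n \<omega>))"
        using X_neq[OF idx'(1,3) neq(1)] X_neq[OF idx'(2,3) neq(2)]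
          Y_neq[OF idx'(4,6) neq(3)] Y_neq[OF idx'(5,6) neq(4)]
        by eventually_elim (simp only: A_wedge B_wedge not_False_eq_True)
      show "(\<lambda>\<omega>. (1/2 - 1 / (2 * pi) * Ang (X i \<omega> - X k \<omega>) (X j \<omega> - X k \<omega>))
          * (1/2 - 1 / (2 * pi) * Ang (Y l \<omega> - Y n \<omega>) (Y m \<omega> - Y n \<omega>))) \<in> borel_measurable M"
        by measurable
    qed (intro borel_measurable_times meas)
  qed
  have G1: "{1, 2, 3, 1, 2, 4} \<subseteq> {1..6::nat}" and G2: "{1, 2, 5, 3, 4, 6} \<subseteq> {1..6::nat}"
    and G3: "{1, 2, 4, 1, 3, 5} \<subseteq> {1..6::nat}"
    by auto
  have int: "integrable unif_sphere (G 1 2 3 1 2 4 \<alpha>)" "integrable unif_sphere (G 1 2 5 3 4 6 \<alpha>)"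
    "integrable unif_sphere (G 1 2 4 1 3 5 \<alpha>)" if "\<alpha> \<in> space unif_sphere" for \<alpha>
    using G(2)[OF G1 _ _ _ _ that] G(2)[OF G2 _ _ _ _ that] G(2)[OF G3 _ _ _ _ that] by simp_all
  \<comment> \<open>Linearity is used twice, for the inner integral at each direction on the sphere
    and then for the outer one.\<close>
  have "(\<integral>\<alpha>. (\<integral>\<beta>. G 1 2 3 1 2 4 \<alpha> \<beta> + G 1 2 5 3 4 6 \<alpha> \<beta> - 2 * G 1 2 4 1 3 5 \<alpha> \<beta>
            \<partial>unif_sphere) \<partial>unif_sphere)
      = (\<integral>\<alpha>. (\<integral>\<beta>. G 1 2 3 1 2 4 \<alpha> \<beta> \<partial>unif_sphere) + (\<integral>\<beta>. G 1 2 5 3 4 6 \<alpha> \<beta> \<partial>unif_sphere)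
            - 2 * (\<integral>\<beta>. G 1 2 4 1 3 5 \<alpha> \<beta> \<partial>unif_sphere) \<partial>unif_sphere)"
    using int by (intro Bochner_Integration.integral_cong refl) simp
  also have "\<dots> = (\<integral>\<alpha>. \<integral>\<beta>. G 1 2 3 1 2 4 \<alpha> \<beta> \<partial>unif_sphere \<partial>unif_sphere)
      + (\<integral>\<alpha>. \<integral>\<beta>. G 1 2 5 3 4 6 \<alpha> \<beta> \<partial>unif_sphere \<partial>unif_sphere)
      - 2 * (\<integral>\<alpha>. \<integral>\<beta>. G 1 2 4 1 3 5 \<alpha> \<beta> \<partial>unif_sphere \<partial>unif_sphere)"
    using G(1)[OF G1] G(1)[OF G2] G(1)[OF G3] by simp
  finally show ?thesis
    unfolding inner using G(3)[OF G1] G(3)[OF G2] G(3)[OF G3] by simp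
qed

end
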